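(* Let $c,C,M>0$ and let $A\subseteq\mathcal V$ be a set with $$\nu_{\|\cdot\|_{w,\infty}}(U(A),r)\le C\,(cr)^{-M},$$ where $r$ denotes the covering radius. Let $A$ and $|\cdot|_y$ be such that $K:=K(U(A))<\infty$, and let $\delta>0$. Then at most $$n\le 2\Big(M\ln\Big(\frac{4\sqrt K}{c\,\delta}\Big)-\ln\Big(\frac{p}{2C}\Big)\Big)\Big(\frac K\delta\Big)^2$$ many samples are required to satisfy $\operatorname{RIP}_A(\delta)$ with probability $1-p$.
   Context: $Y\subseteq\mathbb R^d$ is a Borel set, $\rho$ is a probability measure on $Y$, and $\mathcal V$ is a Banach space of functions with norm $\|v\|=\big(\int_Y|v|_y^2\,d\rho(y)\big)^{1/2}$, where $|\cdot|_y$ is a $y$-dependent seminorm for which this integral is finite for all $v\in\mathcal V$. A weight function is a function $w\ge0$ on $Y$ with $\int_Y w^{-1}\,d\rho=1$; one such $w$ is fixed. The sample points $y_1,\dots,y_n\in Y$ are i.i.d. with $y_i\sim w^{-1}\rho$, and the empirical seminorm is $\|v\|_n:=\big(\frac1n\sum_{i=1}^n w(y_i)|v|_{y_i}^2\big)^{1/2}$. Put $\|v\|_{w,\infty}^2:=\operatorname{ess\,sup}_{y\in Y}w(y)|v|_y^2$ and, for $B\subseteq\mathcal V$, define the variation constant $K(B):=\sup_{u\in B}\|u\|_{w,\infty}^2$. The normalization operator acts on a set $A$ by $U(A):=\{u/\|u\|:u\in A\setminus\{0\}\}$. $\operatorname{RIP}_A(\delta)$ is the property that $(1-\delta)\|u\|^2\le\|u\|_n^2\le(1+\delta)\|u\|^2$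 for all $u\in A$. The covering number $\nu_{\|\cdot\|_{w,\infty}}(B,\varepsilon)$ of a subset $B\subseteq\mathcal V$ is the minimal number of $\|\cdot\|_{w,\infty}$-open balls of radius $\varepsilon$ needed to cover $B$.
   Formalization: Added: for ρ-a.e. y, w(y)|u−v|_y² ≤ ‖u−v‖²_{w,∞} for all u,v in U(A)∪{0} simultaneously (without this the claim can fail for uncountable A); the covering balls are centred in U(A); the covering bound is needed only for 0<r≤δ/(4√K). *)

theory Defs
  imports "HOL-Probability.Probability"
begin

definition seminorm :: "('v::real_vector \<Rightarrow> real) \<Rightarrow> bool" where
  "seminorm s \<longleftrightarrow> (\<forall>v. 0 \<le> s v) \<and> (\<forall>a v. s (a *\<^sub>R v) = \<bar>a\<bar> * s v) \<and>
                 (\<forall>u v. s (u + v) \<le> s u + s v)"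

text \<open>The inverse of a weight is taken in \<^typ>\<open>ennreal\<close>, where the inverse of \<open>0\<close> is \<open>\<infinity>\<close> (in
  \<^typ>\<open>real\<close> it would be \<open>0\<close>). The normalisation therefore forces the weight to be positive almost
  everywhere.\<close>

definition weight_function :: "'y measure \<Rightarrow> ('y \<Rightarrow> real) \<Rightarrow> bool" where
  "weight_function \<rho> w \<longleftrightarrow> w \<in> borel_measurable \<rho> \<and> (\<forall>y\<in>space \<rho>. 0 \<le> w y) \<and>
     (\<integral>\<^sup>+ y. inverse (ennreal (w y)) \<partial>\<rho>) = 1"

definition sampling_measure :: "'y measure \<Rightarrow> ('y \<Rightarrow> real) \<Rightarrow> 'y measure" where
  "sampling_measure \<rho> w = density \<rho> (\<lambda>y. inverse (ennreal (w y)))"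

text \<open>In the definitions below, \<open>sn y v\<close> is the \<open>y\<close>-dependent seminorm of \<open>v\<close>, and
  \<open>y :: nat \<Rightarrow> 'y\<close> is a sample, of which the points \<open>y 1, \<dots>, y n\<close> are used.\<close>

definition empirical_seminorm ::
  "('y \<Rightarrow> real) \<Rightarrow> ('y \<Rightarrow> 'v \<Rightarrow> real) \<Rightarrow> nat \<Rightarrow> (nat \<Rightarrow> 'y) \<Rightarrow> 'v \<Rightarrow> real" where
  "empirical_seminorm w sn n y v = sqrt (1 / real n * (\<Sum>i=1..n. w (y i) * (sn (y i) v)\<^sup>2))"

definition RIP ::
  "('y \<Rightarrow> real) \<Rightarrow> ('y \<Rightarrow> 'v::real_normed_vector \<Rightarrow> real) \<Rightarrow> nat \<Rightarrow> (nat \<Rightarrow> 'y) \<Rightarrow>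
     'v set \<Rightarrow> real \<Rightarrow> bool" where
  "RIP w sn n y A \<delta> \<longleftrightarrow> (\<forall>u\<in>A.
     (1 - \<delta>) * (norm u)\<^sup>2 \<le> (empirical_seminorm w sn n y u)\<^sup>2 \<and>
     (empirical_seminorm w sn n y u)\<^sup>2 \<le> (1 + \<delta>) * (norm u)\<^sup>2)"

definition winf_norm_sq ::
  "'y measure \<Rightarrow> ('y \<Rightarrow> real) \<Rightarrow> ('y \<Rightarrow> 'v \<Rightarrow> real) \<Rightarrow> 'v \<Rightarrow> ennreal" where
  "winf_norm_sq \<rho> w sn v = esssup \<rho> (\<lambda>y. ennreal (w y * (sn y v)\<^sup>2))"

definition winf_norm ::
  "'y measure \<Rightarrow> ('y \<Rightarrow> real) \<Rightarrow> ('y \<Rightarrow> 'v \<Rightarrow> real) \<Rightarrow> 'v \<Rightarrow> ennreal" where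
  "winf_norm \<rho> w sn v =
     (if winf_norm_sq \<rho> w sn v = \<infinity> then \<infinity> else ennreal (sqrt (enn2real (winf_norm_sq \<rho> w sn v))))"

definition variation_constant ::
  "'y measure \<Rightarrow> ('y \<Rightarrow> real) \<Rightarrow> ('y \<Rightarrow> 'v \<Rightarrow> real) \<Rightarrow> 'v set \<Rightarrow> ennreal" where
  "variation_constant \<rho> w sn B = (SUP u\<in>B. winf_norm_sq \<rho> w sn u)"

definition normalization :: "'v::real_normed_vector set \<Rightarrow> 'v set" where
  "normalization A = {u /\<^sub>R norm u | u. u \<in> A - {0}}"

text \<open>The norm \<open>N\<close> may take the value \<open>\<infinity>\<close>, and the covering number is \<open>\<infinity>\<close> if there is no finite
  cover. The balls are those of the metric subspace \<open>B\<close>, so their centres lie in \<open>B\<close>. With centres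
  outside \<open>B\<close> the number can be smaller, and then the constants of the sample bound fail.\<close>

definition covering_number ::
  "('v::ab_group_add \<Rightarrow> ennreal) \<Rightarrow> 'v set \<Rightarrow> real \<Rightarrow> enat" where
  "covering_number N B \<epsilon> =
     Inf {enat (card S) | S. finite S \<and> S \<subseteq> B \<and> B \<subseteq> (\<Union>c\<in>S. {v. N (v - c) < ennreal \<epsilon>})}"

end

theory Submission
  imports Defs
begin

text \<open>By homogeneity only the unit vectors \<open>u \<in> U(A)\<close> matter. For such a \<open>u\<close> the variables
  \<open>w(y\<^sub>i) |u|\<^sup>2\<close> lie in \<open>[0, K]\<close> and have mean \<open>1\<close>, so by Hoeffding's inequality their average deviates
  from \<open>1\<close> by \<open>\<delta>/2\<close> or more with probability at most \<open>2 exp(- n \<delta>\<^sup>2 / (2 K\<^sup>2))\<close>. A union bound covers the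
  centres of an \<open>r\<close>-net of \<open>U(A)\<close> with \<open>r = \<delta> / (4 \<surd>K)\<close>. Passing from \<open>u\<close> to the nearest centre \<open>v\<close>
  costs \<open>|a\<^sup>2 - b\<^sup>2| = |a - b| (a + b) \<le> r \<cdot> 2 \<surd>K = \<delta>/2\<close> in every summand, where \<open>a\<close> and \<open>b\<close> are the
  weighted seminorms of \<open>u\<close> and \<open>v\<close> at the sample point.\<close>

section \<open>Elementary properties of seminorms\<close>

lemma seminorm_nonneg: "seminorm s \<Longrightarrow> 0 \<le> s v"
  and seminorm_scaleR: "seminorm s \<Longrightarrow> s (a *\<^sub>R v) = \<bar>a\<bar> * s v"
  and seminorm_triangle: "seminorm s \<Longrightarrow> s (u + v) \<le> s u + s v"
  by (simp_all add: seminorm_def)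

lemma seminorm_zero: "seminorm s \<Longrightarrow> s 0 = 0"
  using seminorm_scaleR[of s 0 0] by simp

lemma seminorm_abs_diff_le:
  assumes "seminorm s"
  shows "\<bar>s u - s v\<bar> \<le> s (u - v)"
  using seminorm_triangle[OF assms, of "u - v" v] seminorm_triangle[OF assms, of "v - u" u]
    seminorm_scaleR[OF assms, of "-1" "u - v"]
  by simp

lemma weighted_seminorm_sq_diff_le:
  assumes s: "seminorm s" and a: "0 \<le> a" and r: "0 \<le> r"
    and uv: "a * (s (u - v))\<^sup>2 \<le> r\<^sup>2" and u: "a * (s u)\<^sup>2 \<le> K" and v: "a * (s v)\<^sup>2 \<le> K"
  shows "\<bar>a * (s u)\<^sup>2 - a * (s v)\<^sup>2\<bar> \<le> 2 * sqrt K * r"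
proof -
  have root: "sqrt a * s z = sqrt (a * (s z)\<^sup>2)" for z
    using s by (simp add: real_sqrt_mult seminorm_nonneg)
  have "sqrt a * \<bar>s u - s v\<bar> \<le> sqrt a * s (u - v)"
    using seminorm_abs_diff_le[OF s] a by (simp add: mult_left_mono)
  also have "\<dots> \<le> r"
    unfolding root using uv r real_le_lsqrt by blast
  finally have diff: "sqrt a * \<bar>s u - s v\<bar> \<le> r" .
  have "sqrt a * s u \<le> sqrt K" "sqrt a * s v \<le> sqrt K"
    unfolding root using u v by simp_all
  then have sum: "sqrt a * (s u + s v) \<le> 2 * sqrt K"
    by (simp add: algebra_simps)
  \<comment> \<open>Each factor of the difference of squares absorbs one copy of
    \<open>sqrt a\<close>.\<close>
  have "a * (s u)\<^sup>2 - a * (s v)\<^sup>2 = (sqrt a)\<^sup>2 * ((s u - s v) * (s u + s v))"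
    using a by (simp add: power2_eq_square algebra_simps)
  then have "\<bar>a * (s u)\<^sup>2 - a * (s v)\<^sup>2\<bar> = (sqrt a * (s u + s v)) * (sqrt a * \<bar>s u - s v\<bar>)"
    using s seminorm_nonneg[OF s, of u] seminorm_nonneg[OF s, of v]
    by (simp add: abs_mult power2_eq_square)
  also have "\<dots> \<le> (2 * sqrt K) * r"
    \<comment> \<open>That \<open>K\<close> is nonnegative is read off from \<open>u\<close>, since
      \<open>a * (s u)\<^sup>2\<close> lies between 0 and \<open>K\<close>.\<close>
    using s by (intro mult_mono[OF sum diff]) (use a order_trans[OF _ u, of 0] in auto)
  finally show ?thesis .
qed

section \<open>The weight and the sampling measure\<close>

lemma AE_weight_pos:
  assumes "weight_function \<rho> w"
  shows "AE x in \<rho>. 0 < w x"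
proof -
  have [measurable]: "w \<in> borel_measurable \<rho>"
    using assms by (simp add: weight_function_def)
  \<comment> \<open>At a zero of \<open>w\<close> the integrand is infinite, and an integrand with
    integral 1 is infinite only on a null set.\<close>
  have "AE x in \<rho>. inverse (ennreal (w x)) \<noteq> \<infinity>"
    using assms by (intro nn_integral_PInf_AE) (auto simp: weight_function_def)
  then show ?thesis
    by eventually_elim (auto simp: ennreal_eq_0_iff not_le)
qed

text \<open>The sampling measure has a density with respect to \<open>\<rho>\<close>, so it inherits
  the null sets of \<open>\<rho>\<close>.\<close>

lemma AE_sampling_measure:
  assumes "weight_function \<rho> w" and "AE x in \<rho>. Q x"
  shows "AE x in sampling_measure \<rho> w. Q x"
proof -
  have [measurable]: "w \<in> borel_measurable \<rho>"
    using assms by (simp add: weight_function_def)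
  show ?thesis
    using assms(2) unfolding sampling_measure_def by (subst AE_density) auto
qed

lemma prob_space_sampling_measure:
  assumes "weight_function \<rho> w"
  shows "prob_space (sampling_measure \<rho> w)"
proof
  have [measurable]: "w \<in> borel_measurable \<rho>"
    using assms by (simp add: weight_function_def)
  have "emeasure (sampling_measure \<rho> w) (space \<rho>) = (\<integral>\<^sup>+ x. inverse (ennreal (w x)) \<partial>\<rho>)"
    unfolding sampling_measure_def
    by (subst emeasure_density) (auto intro!: nn_integral_cong)
  then show "emeasure (sampling_measure \<rho> w) (space (sampling_measure \<rho> w)) = 1"
    using assms by (simp add: weight_function_def sampling_measure_def)
qed

text \<open>Where \<open>w\<close> is positive, hence almost everywhere, it cancels the density. The
  detour through nonnegative integrals avoids integrability: if they are infinite, both Bochner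
  integrals are 0 by convention.\<close>

lemma integral_sampling_measure:
  assumes "weight_function \<rho> w" and [measurable]: "f \<in> borel_measurable \<rho>" and "\<And>x. 0 \<le> f x"
  shows "(\<integral>x. w x * f x \<partial>sampling_measure \<rho> w) = (\<integral>x. f x \<partial>\<rho>)"
proof -
  have [measurable]: "w \<in> borel_measurable \<rho>" and w: "AE x in \<rho>. 0 < w x"
    using assms AE_weight_pos by (auto simp: weight_function_def)
  have "(\<integral>\<^sup>+x. ennreal (w x * f x) \<partial>sampling_measure \<rho> w) =
      (\<integral>\<^sup>+x. inverse (ennreal (w x)) * ennreal (w x * f x) \<partial>\<rho>)"
    unfolding sampling_measure_def by (intro nn_integral_density) auto
  also have "\<dots> = (\<integral>\<^sup>+x. ennreal (f x) \<partial>\<rho>)"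
  proof (rule nn_integral_cong_AE, use w in eventually_elim)
    fix x assume "0 < w x"
    then show "inverse (ennreal (w x)) * ennreal (w x * f x) = ennreal (f x)"
      using assms(3)[of x] by (simp add: inverse_ennreal ennreal_mult[symmetric])
  qed
  finally have eq: "(\<integral>\<^sup>+x. ennreal (w x * f x) \<partial>sampling_measure \<rho> w) = (\<integral>\<^sup>+x. ennreal (f x) \<partial>\<rho>)" .
  have "AE x in sampling_measure \<rho> w. 0 \<le> w x * f x"
    by (intro AE_sampling_measure assms(1), use w in eventually_elim) (simp add: assms(3))
  then have "(\<integral>x. w x * f x \<partial>sampling_measure \<rho> w) =
      enn2real (\<integral>\<^sup>+x. ennreal (w x * f x) \<partial>sampling_measure \<rho> w)"
    by (intro integral_eq_nn_integral) (simp_all add: sampling_measure_def)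
  also have "\<dots> = (\<integral>x. f x \<partial>\<rho>)"
    unfolding eq using assms(3) by (intro integral_eq_nn_integral[symmetric]) auto
  finally show ?thesis .
qed

section \<open>Covering numbers and the weighted supremum norm\<close>

lemma covering_number_attained:
  assumes "covering_number N B \<epsilon> \<noteq> \<infinity>"
  obtains S where "finite S" "S \<subseteq> B" "B \<subseteq> (\<Union>c\<in>S. {v. N (v - c) < ennreal \<epsilon>})"
    "covering_number N B \<epsilon> = enat (card S)"
proof -
  let ?X = "{enat (card S) | S. finite S \<and> S \<subseteq> B \<and> B \<subseteq> (\<Union>c\<in>S. {v. N (v - c) < ennreal \<epsilon>})}"
  \<comment> \<open>The infimum of the empty set is infinity, which is excluded; on a nonempty set
    of \<open>enat\<close> it is a minimum by well-ordering.\<close>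
  have "?X \<noteq> {}"
    using assms unfolding covering_number_def by (auto simp: Inf_enat_def split: if_splits)
  then have "Inf ?X \<in> ?X"
    unfolding Inf_enat_def by (metis (no_types, lifting) LeastI ex_in_conv)
  then show thesis
    using that unfolding covering_number_def by blast
qed

lemma winf_norm_less_imp_sq_le:
  assumes "winf_norm \<rho> w sn v < ennreal r" and "0 \<le> r"
  shows "winf_norm_sq \<rho> w sn v \<le> ennreal (r\<^sup>2)"
proof (cases "winf_norm_sq \<rho> w sn v = \<infinity>")
  case False
  then obtain q where q: "winf_norm_sq \<rho> w sn v = ennreal q" "0 \<le> q"
    by (cases "winf_norm_sq \<rho> w sn v") auto
  then have "sqrt q < r"
    using assms by (simp add: winf_norm_def ennreal_less_iff)
  then show ?thesis
    using q assms by (simp add: ennreal_leI sqrt_le_D)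
qed (use assms in \<open>simp add: winf_norm_def\<close>)

section \<open>Reduction of the RIP to unit vectors\<close>

lemma norm_normalization: "u \<in> normalization A \<Longrightarrow> norm u = 1"
  by (auto simp: normalization_def)

lemma empirical_seminorm_sq:
  assumes "\<And>i. i \<in> {1..n} \<Longrightarrow> 0 \<le> w (y i)"
  shows "(empirical_seminorm w sn n y u)\<^sup>2 = (\<Sum>i=1..n. w (y i) * (sn (y i) u)\<^sup>2) / real n"
  unfolding empirical_seminorm_def
  using assms by (subst real_sqrt_pow2) (auto intro!: sum_nonneg divide_nonneg_nonneg)

text \<open>All three terms of the RIP scale with the squared norm. The vector 0 has no
  normalization, but there all three terms vanish.\<close>

lemma RIP_normalizationI:
  assumes "\<And>i. i \<in> {1..n} \<Longrightarrow> seminorm (sn (y i))" and w: "\<And>i. i \<in> {1..n} \<Longrightarrow> 0 \<le> w (y i)"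
    and dev: "\<And>u. u \<in> normalization A \<Longrightarrow>
      \<bar>(\<Sum>i=1..n. w (y i) * (sn (y i) u)\<^sup>2) / real n - 1\<bar> \<le> \<delta>"
  shows "RIP w sn n y A \<delta>"
  unfolding RIP_def
proof
  fix u assume "u \<in> A"
  show "(1 - \<delta>) * (norm u)\<^sup>2 \<le> (empirical_seminorm w sn n y u)\<^sup>2 \<and>
    (empirical_seminorm w sn n y u)\<^sup>2 \<le> (1 + \<delta>) * (norm u)\<^sup>2"
  proof (cases "u = 0")
    case True
    then show ?thesis
      using assms(1) by (simp add: empirical_seminorm_def seminorm_zero)
  next
    case False
    define v where "v = u /\<^sub>R norm u"
    define e where "e = (\<Sum>i=1..n. w (y i) * (sn (y i) v)\<^sup>2) / real n"
    have "v \<in> normalization A"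
      using \<open>u \<in> A\<close> False by (auto simp: v_def normalization_def)
    then have e: "1 - \<delta> \<le> e" "e \<le> 1 + \<delta>"
      using dev[of v] by (auto simp: e_def)
    have "sn (y i) u = norm u * sn (y i) v" if "i \<in> {1..n}" for i
      using seminorm_scaleR[OF assms(1)[OF that], of "norm u" v] False by (simp add: v_def)
    then have "(\<Sum>i=1..n. w (y i) * (sn (y i) u)\<^sup>2) =
        (norm u)\<^sup>2 * (\<Sum>i=1..n. w (y i) * (sn (y i) v)\<^sup>2)"
      unfolding sum_distrib_left by (intro sum.cong) (auto simp: power_mult_distrib)
    moreover have "(empirical_seminorm w sn n y u)\<^sup>2 =
        (\<Sum>i=1..n. w (y i) * (sn (y i) u)\<^sup>2) / real n"
      using w by (rule empirical_seminorm_sq)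
    ultimately have "(empirical_seminorm w sn n y u)\<^sup>2 = e * (norm u)\<^sup>2"
      by (simp add: e_def)
    then show ?thesis
      using e by (simp add: mult_right_mono)
  qed
qed

section \<open>Hoeffding's inequality for sample means and the union bound\<close>

lemma Hoeffding_sample_mean:
  fixes K t :: real
  assumes "prob_space P" and "prob_space.indep_vars P (\<lambda>_. M) y I" and "finite I" "I \<noteq> {}"
    and D: "\<And>i. i \<in> I \<Longrightarrow> distr P M (y i) = D"
    and f[measurable]: "f \<in> borel_measurable M"
    and bound: "AE x in D. 0 \<le> f x \<and> f x \<le> K" and "0 < K" "0 \<le> t"
  shows "measure P {\<omega> \<in> space P. t \<le> \<bar>(\<Sum>i\<in>I. f (y i \<omega>)) / card I - (\<integral>x. f x \<partial>D)\<bar>}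
    \<le> 2 * exp (- 2 * card I * t\<^sup>2 / K\<^sup>2)"
proof -
  interpret P: prob_space P by fact
  have y[measurable]: "y i \<in> measurable P M" if "i \<in> I" for i
    using assms(2) that by (auto simp: P.indep_vars_def)
  have mean: "P.expectation (\<lambda>\<omega>. f (y i \<omega>)) = (\<integral>x. f x \<partial>D)" if "i \<in> I" for i
    unfolding D[OF that, symmetric] using y[OF that] by (simp add: integral_distr)
  have AE: "AE \<omega> in P. f (y i \<omega>) \<in> {0..K}" if "i \<in> I" for i
  proof -
    have "AE x in distr P M (y i). f x \<in> {0..K}"
      unfolding D[OF that] using bound by eventually_elim simp
    then show ?thesis
      by (rule AE_distrD[OF y[OF that]])
  qed
  interpret H: Hoeffding_ineq P I "\<lambda>i \<omega>. f (y i \<omega>)" "\<lambda>_. 0" "\<lambda>_. K"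
    "\<Sum>i\<in>I. P.expectation (\<lambda>\<omega>. f (y i \<omega>))"
  proof unfold_locales
    show "P.indep_vars (\<lambda>_. borel) (\<lambda>i \<omega>. f (y i \<omega>)) I"
      by (rule P.indep_vars_compose2[OF assms(2)]) simp
  qed (use AE \<open>finite I\<close> in auto)
  have n: "0 < real (card I)"
    using assms(3,4) by (simp add: card_gt_0_iff)
  \<comment> \<open>Hoeffding's inequality speaks of sums, so the mean and its threshold are
    multiplied by \<open>card I\<close>.\<close>
  have "\<bar>s / card I - m\<bar> = \<bar>s - card I * m\<bar> / card I" for s m :: real
    using n abs_divide[of "s - card I * m" "real (card I)"] by (simp add: diff_divide_distrib)
  then have "{\<omega> \<in> space P. t \<le> \<bar>(\<Sum>i\<in>I. f (y i \<omega>)) / card I - (\<integral>x. f x \<partial>D)\<bar>} =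
    {\<omega> \<in> space P. card I * t \<le>
      \<bar>(\<Sum>i\<in>I. f (y i \<omega>)) - (\<Sum>i\<in>I. P.expectation (\<lambda>\<omega>. f (y i \<omega>)))\<bar>}"
    using n by (simp add: mean field_simps)
  also have "measure P \<dots> \<le> 2 * exp (- 2 * (card I * t)\<^sup>2 / (\<Sum>i\<in>I. (K - 0)\<^sup>2))"
    using n \<open>0 < K\<close> \<open>0 \<le> t\<close> by (intro H.Hoeffding_ineq_abs_ge) auto
  \<comment> \<open>The denominator is \<open>card I * K\<^sup>2\<close>, which cancels one of the
    two factors \<open>card I\<close> above it.\<close>
  also have "- 2 * (card I * t)\<^sup>2 / (\<Sum>i\<in>I. (K - 0)\<^sup>2) = - 2 * card I * t\<^sup>2 / K\<^sup>2"
    using n \<open>0 < K\<close> by (simp add: field_simps power2_eq_square)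
  finally show ?thesis .
qed

text \<open>The size of the sample is chosen to make the union bound over the net come out as \<open>p\<close>.\<close>

lemma union_bound_le:
  fixes c C M \<delta> p K n :: real
  assumes "0 < c" "0 < C" "0 < \<delta>" "0 < p" "0 < K"
    and n: "n \<ge> 2 * (M * ln (4 * sqrt K / (c * \<delta>)) - ln (p / (2 * C))) * (K / \<delta>)\<^sup>2"
  shows "C * (c * (\<delta> / (4 * sqrt K))) powr (- M) * (2 * exp (- 2 * n * (\<delta> / 2)\<^sup>2 / K\<^sup>2)) \<le> p"
proof -
  define L where "L = ln (4 * sqrt K / (c * \<delta>))"
  define l where "l = ln (p / (2 * C))"
  have pos: "0 < 4 * sqrt K / (c * \<delta>)"
    using assms by simp
  \<comment> \<open>The base of the covering bound is the reciprocal of the argument of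
    \<open>L\<close>, so its power \<open>- M\<close> is \<open>exp (M * L)\<close>.\<close>
  have inv: "c * (\<delta> / (4 * sqrt K)) = inverse (4 * sqrt K / (c * \<delta>))"
    by (simp add: field_simps)
  have "2 * (M * L - l) \<le> n * \<delta>\<^sup>2 / K\<^sup>2"
    using n assms(3,5) by (simp add: L_def l_def field_simps power_divide)
  \<comment> \<open>The exponent is minus one half of
    \<open>n * \<delta>\<^sup>2 / K\<^sup>2\<close>, which uses up the factor 2 in the bound on
    \<open>n\<close>.\<close>
  then have expo: "- 2 * n * (\<delta> / 2)\<^sup>2 / K\<^sup>2 \<le> l - M * L"
    by (simp add: power_divide)
  have "(c * (\<delta> / (4 * sqrt K))) powr (- M) = exp (M * L)"
    unfolding inv L_def powr_def ln_inverse using assms by simp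
  then have "C * (c * (\<delta> / (4 * sqrt K))) powr (- M) * (2 * exp (- 2 * n * (\<delta> / 2)\<^sup>2 / K\<^sup>2)) \<le>
      C * exp (M * L) * (2 * exp (l - M * L))"
    using expo \<open>0 < C\<close> by simp
  also have "\<dots> = 2 * C * exp l"
    by (simp add: exp_diff)
  \<comment> \<open>The term \<open>ln (p / (2 * C))\<close> in the sample size serves to cancel
    \<open>C\<close> from the covering and 2 from the two-sided tail.\<close>
  also have "\<dots> = p"
    using assms by (simp add: l_def)
  finally show ?thesis .
qed

theorem corollary2p10:
  fixes Y :: "(real ^ 'd) set"
    and \<rho> :: "(real ^ 'd) measure"
    and sn :: "real ^ 'd \<Rightarrow> 'v::banach \<Rightarrow> real"
    and w :: "real ^ 'd \<Rightarrow> real"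
    and A :: "'v set"
    and c C M \<delta> p K :: real
    and n :: nat
    and P :: "'w measure"
    and y :: "nat \<Rightarrow> 'w \<Rightarrow> real ^ 'd"
  assumes "Y \<in> sets borel"
    and "prob_space \<rho>" and "space \<rho> = Y" and "sets \<rho> = sets (restrict_space borel Y)"
    and "\<And>x. x \<in> Y \<Longrightarrow> seminorm (sn x)"
    and "\<And>v. integrable \<rho> (\<lambda>x. (sn x v)\<^sup>2)"
    and "\<And>v. norm v = sqrt (\<integral>x. (sn x v)\<^sup>2 \<partial>\<rho>)"
    and "weight_function \<rho> w"
    and "c > 0" and "C > 0" and "M > 0" and "\<delta> > 0" and "p > 0"
    and "variation_constant \<rho> w sn (normalization A) < \<infinity>"
    and "K = enn2real (variation_constant \<rho> w sn (normalization A))"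
    and "\<And>r. 0 < r \<Longrightarrow> r \<le> \<delta> / (4 * sqrt K) \<Longrightarrow>
           ennreal_of_enat (covering_number (winf_norm \<rho> w sn) (normalization A) r)
             \<le> ennreal (C * (c * r) powr (- M))"
    \<comment> \<open>the essential supremum bounds hold off one null set common to all these vectors\<close>
    and "AE x in \<rho>. \<forall>u \<in> insert 0 (normalization A). \<forall>v \<in> insert 0 (normalization A).
           ennreal (w x * (sn x (u - v))\<^sup>2) \<le> winf_norm_sq \<rho> w sn (u - v)"
    and "prob_space P"
    and "prob_space.indep_vars P (\<lambda>_. \<rho>) y {1..n}"
    and "\<And>i. i \<in> {1..n} \<Longrightarrow> distr P \<rho> (y i) = sampling_measure \<rho> w"
    and "real n \<ge> 2 * (M * ln (4 * sqrt K / (c * \<delta>)) - ln (p / (2 * C))) * (K / \<delta>)\<^sup>2"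
  shows "\<exists>E \<in> sets P. measure P E \<ge> 1 - p \<and> (\<forall>\<omega>\<in>E. RIP w sn n (\<lambda>i. y i \<omega>) A \<delta>)"
proof -
  interpret P: prob_space P by fact
  interpret D: prob_space "sampling_measure \<rho> w"
    using assms(8) by (rule prob_space_sampling_measure)
  let ?U = "normalization A"
  define f where "f = (\<lambda>u x. w x * (sn x u)\<^sup>2)"
  have w[measurable]: "w \<in> borel_measurable \<rho>" and w0: "\<And>x. x \<in> Y \<Longrightarrow> 0 \<le> w x"
    using assms(3,8) by (auto simp: weight_function_def)
  have sn[measurable]: "(\<lambda>x. (sn x v)\<^sup>2) \<in> borel_measurable \<rho>" for v
    using assms(6) by (rule borel_measurable_integrable)
  have f[measurable]: "f v \<in> borel_measurable \<rho>" for v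
    by (simp add: f_def)
  have y[measurable]: "y i \<in> measurable P \<rho>" if "i \<in> {1..n}" for i
    using assms(19) that by (auto simp: P.indep_vars_def)
  have yY: "y i \<omega> \<in> Y" if "i \<in> {1..n}" "\<omega> \<in> space P" for i \<omega>
    using measurable_space[OF y] that assms(3) by auto
  have RIP: "RIP w sn n (\<lambda>i. y i \<omega>) A \<delta>"
    if "\<omega> \<in> space P" "\<And>u. u \<in> ?U \<Longrightarrow> \<bar>(\<Sum>i=1..n. f u (y i \<omega>)) / real n - 1\<bar> \<le> \<delta>" for \<omega>
    using that yY w0 assms(5) by (intro RIP_normalizationI) (auto simp: f_def)
  \<comment> \<open>For \<open>1 \<le> p\<close> the empty event suffices, and without unit vectors
    every sample works. The remaining case yields \<open>0 < K\<close> and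
    \<open>0 < n\<close>.\<close>
  consider "1 \<le> p" | "?U = {}" | "p < 1" "?U \<noteq> {}"
    by fastforce
  then show ?thesis
  proof cases
    case 1
    then show ?thesis
      by (intro bexI[of _ "{}"]) auto
  next
    case 2
    then show ?thesis
      using RIP \<open>p > 0\<close> by (intro bexI[of _ "space P"]) (auto simp: P.prob_space)
  next
    case 3
    \<comment> \<open>One condition on \<open>x\<close> serves all differences at once, as
      \<open>?U\<close> may be uncountable. Inserting 0 also covers the unit vectors themselves, as
      \<open>u - 0\<close>.\<close>
    define good where "good x \<longleftrightarrow> (\<forall>u \<in> insert 0 ?U. \<forall>v \<in> insert 0 ?U.
      ennreal (f (u - v) x) \<le> winf_norm_sq \<rho> w sn (u - v))" for x
    have good_AE: "AE x in sampling_measure \<rho> w. good x \<and> x \<in> Y"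
      using assms(3,8,17) unfolding good_def f_def
      by (intro AE_sampling_measure AE_conjI) (auto intro: AE_I2)
    have "winf_norm_sq \<rho> w sn u \<le> ennreal K" if "u \<in> ?U" for u
      using assms(14,15) that by (auto simp: variation_constant_def intro: SUP_upper)
    then have f_le: "f u x \<le> K" if "u \<in> ?U" "good x" for u x
      using that assms(15) order_trans[of "ennreal (f u x)" "winf_norm_sq \<rho> w sn u" "ennreal K"]
      by (force simp: good_def ennreal_le_iff)
    have f_bound: "AE x in sampling_measure \<rho> w. 0 \<le> f u x \<and> f u x \<le> K" if "u \<in> ?U" for u
      using good_AE by eventually_elim (use f_le that w0 in \<open>auto simp: f_def\<close>)
    have mean: "(\<integral>x. f u x \<partial>sampling_measure \<rho> w) = 1" if "u \<in> ?U" for u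
    proof -
      have "(\<integral>x. f u x \<partial>sampling_measure \<rho> w) = (\<integral>x. (sn x u)\<^sup>2 \<partial>\<rho>)"
        unfolding f_def using assms(8) by (intro integral_sampling_measure) auto
      also have "\<dots> = 1"
        using assms(7)[of u] norm_normalization[OF that] by simp
      finally show ?thesis .
    qed
    obtain u0 where u0: "u0 \<in> ?U"
      using 3 by blast
    \<comment> \<open>Otherwise \<open>f u0\<close> would vanish almost everywhere, although its
      mean is 1.\<close>
    have "0 < K"
    proof (rule ccontr)
      assume "\<not> 0 < K"
      have "AE x in sampling_measure \<rho> w. f u0 x = 0"
        using f_bound[OF u0] by eventually_elim (use \<open>\<not> 0 < K\<close> in auto)
      then have "(\<integral>x. f u0 x \<partial>sampling_measure \<rho> w) = 0"
        by (rule integral_eq_zero_AE)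
      then show False
        using mean[OF u0] by simp
    qed
    \<comment> \<open>This is the largest radius at which the covering hypothesis is
      available.\<close>
    define r where "r = \<delta> / (4 * sqrt K)"
    have r: "0 < r"
      using \<open>0 < K\<close> \<open>\<delta> > 0\<close> by (simp add: r_def)
    have cover: "ennreal_of_enat (covering_number (winf_norm \<rho> w sn) ?U r)
        \<le> ennreal (C * (c * r) powr (- M))"
      using r by (intro assms(16)) (simp_all add: r_def)
    then have "covering_number (winf_norm \<rho> w sn) ?U r \<noteq> \<infinity>"
      by (metis ennreal_less_top ennreal_of_enat_infty infinity_ennreal_def not_le)
    then obtain S where S: "finite S" "S \<subseteq> ?U"
      "?U \<subseteq> (\<Union>v\<in>S. {u. winf_norm \<rho> w sn (u - v) < ennreal r})"
      "covering_number (winf_norm \<rho> w sn) ?U r = enat (card S)"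
      by (rule covering_number_attained)
    have card_S: "real (card S) \<le> C * (c * r) powr (- M)"
      using cover S(4) \<open>C > 0\<close> by (simp add: ennreal_of_nat_eq_real_of_nat)
    have "S \<noteq> {}"
      using S(3) u0 by auto
    \<comment> \<open>The bound on the failure probability at a single centre, with deviation
      \<open>\<delta> / 2\<close>.\<close>
    define q where "q = 2 * exp (- 2 * real n * (\<delta> / 2)\<^sup>2 / K\<^sup>2)"
    have "real (card S) * q \<le> C * (c * r) powr (- M) * q"
      using card_S by (intro mult_right_mono) (simp_all add: q_def)
    also have "\<dots> \<le> p"
      unfolding r_def q_def using assms \<open>0 < K\<close> by (intro union_bound_le) auto
    finally have Sq: "real (card S) * q \<le> p" .
    \<comment> \<open>An empty sample would give \<open>q = 2\<close>, so the nonempty net would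
      force \<open>2 \<le> p\<close>.\<close>
    have "0 < n"
    proof (rule ccontr)
      assume "\<not> 0 < n"
      then have "2 * real (card S) \<le> p"
        using Sq by (simp add: q_def)
      moreover have "1 \<le> card S"
        using S(1) \<open>S \<noteq> {}\<close> by (simp add: Suc_le_eq card_gt_0_iff)
      ultimately show False
        using \<open>p < 1\<close> by linarith
    qed
    define B where "B v = {\<omega> \<in> space P. \<delta> / 2 \<le> \<bar>(\<Sum>i=1..n. f v (y i \<omega>)) / real n - 1\<bar>}" for v
    have B_sets[measurable]: "B v \<in> sets P" for v
      unfolding B_def by measurable
    have B_prob: "measure P (B v) \<le> q" if "v \<in> S" for v
      using Hoeffding_sample_mean[OF assms(18,19) _ _ assms(20) f f_bound \<open>0 < K\<close>, of v "\<delta> / 2"]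
        mean[of v] that S(2) \<open>0 < n\<close> \<open>\<delta> > 0\<close> by (auto simp: B_def q_def)
    have "AE \<omega> in P. \<forall>i\<in>{1..n}. good (y i \<omega>)"
    proof (rule AE_finite_allI)
      fix i assume i: "i \<in> {1..n}"
      have "AE x in distr P \<rho> (y i). good x"
        using good_AE unfolding assms(20)[OF i] by eventually_elim auto
      then show "AE \<omega> in P. good (y i \<omega>)"
        by (rule AE_distrD[OF y[OF i]])
    qed simp
    \<comment> \<open>The condition \<open>good\<close> may quantify over uncountably many vectors,
      so its failure set is enclosed in a measurable null set.\<close>
    then obtain Z where Z: "{\<omega> \<in> space P. \<not> (\<forall>i\<in>{1..n}. good (y i \<omega>))} \<subseteq> Z" "emeasure P Z = 0"
      "Z \<in> sets P"
      by (rule AE_E)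
    \<comment> \<open>Outside \<open>F\<close> every centre has a small deviation and every sample
      point is good.\<close>
    define F where "F = Z \<union> (\<Union>v\<in>S. B v)"
    have F[measurable]: "F \<in> sets P"
      unfolding F_def using S(1) Z(3) by (intro sets.Un sets.finite_UN) auto
    have "measure P F \<le> measure P Z + measure P (\<Union>v\<in>S. B v)"
      unfolding F_def using S(1) Z(3) by (intro measure_Un_le) auto
    also have "measure P Z = 0"
      using Z(2) by (simp add: measure_def)
    also have "measure P (\<Union>v\<in>S. B v) \<le> (\<Sum>v\<in>S. measure P (B v))"
      using S(1) by (intro measure_UNION_le) auto
    also have "\<dots> \<le> real (card S) * q"
      using B_prob by (intro sum_bounded_above) auto
    finally have "measure P (space P - F) \<ge> 1 - p"
      using Sq P.prob_compl[OF F] by simp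
    moreover have "RIP w sn n (\<lambda>i. y i \<omega>) A \<delta>" if \<omega>: "\<omega> \<in> space P - F" for \<omega>
    proof (rule RIP)
      fix u assume u: "u \<in> ?U"
      then obtain v where v: "v \<in> S" "winf_norm \<rho> w sn (u - v) < ennreal r"
        using S(3) by blast
      then have vU: "v \<in> ?U"
        using S(2) by blast
      have near: "\<bar>f u (y i \<omega>) - f v (y i \<omega>)\<bar> \<le> \<delta> / 2" if i: "i \<in> {1..n}" for i
      proof -
        have good: "good (y i \<omega>)"
          using \<omega> Z(1) i unfolding F_def by blast
        then have "ennreal (f (u - v) (y i \<omega>)) \<le> winf_norm_sq \<rho> w sn (u - v)"
          using u vU by (auto simp: good_def)
        also have "\<dots> \<le> ennreal (r\<^sup>2)"
          using v(2) r by (intro winf_norm_less_imp_sq_le) auto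
        finally have "f (u - v) (y i \<omega>) \<le> r\<^sup>2"
          by (simp add: ennreal_le_iff)
        then have "\<bar>f u (y i \<omega>) - f v (y i \<omega>)\<bar> \<le> 2 * sqrt K * r"
          using f_le[OF u good] f_le[OF vU good] r yY[OF i] \<omega> w0 assms(5) unfolding f_def
          by (intro weighted_seminorm_sq_diff_le) auto
        also have "\<dots> = \<delta> / 2"
          using \<open>0 < K\<close> by (simp add: r_def)
        finally show ?thesis .
      qed
      have "\<bar>(\<Sum>i=1..n. f u (y i \<omega>)) - (\<Sum>i=1..n. f v (y i \<omega>))\<bar>
          \<le> (\<Sum>i=1..n. \<bar>f u (y i \<omega>) - f v (y i \<omega>)\<bar>)"
        unfolding sum_subtractf[symmetric] by (rule sum_abs)
      also have "\<dots> \<le> real n * (\<delta> / 2)"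
        using sum_bounded_above[of "{1..n}", OF near] by simp
      finally have "\<bar>(\<Sum>i=1..n. f u (y i \<omega>)) / real n - (\<Sum>i=1..n. f v (y i \<omega>)) / real n\<bar> \<le> \<delta> / 2"
        using \<open>0 < n\<close> by (simp add: diff_divide_distrib[symmetric] abs_divide field_simps)
      \<comment> \<open>The centre \<open>v\<close> was fixed before sampling, and
        \<open>\<omega>\<close> avoids its bad event \<open>B v\<close>; this supplies the other
        half of \<open>\<delta>\<close>.\<close>
      moreover have "\<bar>(\<Sum>i=1..n. f v (y i \<omega>)) / real n - 1\<bar> < \<delta> / 2"
        using \<omega> v(1) by (force simp: F_def B_def)
      ultimately show "\<bar>(\<Sum>i=1..n. f u (y i \<omega>)) / real n - 1\<bar> \<le> \<delta>"
        by linarith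
    qed (use \<omega> in simp)
    ultimately show ?thesis
      by (intro bexI[of _ "space P - F"]) auto
  qed
qed

end
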